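(* Let $H=(A,B,E)$ be a finite simple bipartite graph with parts $A$ and $B$, let $q$ be a positive integer such that $H$ has at least one proper $q$-coloring, and let $c$ be a proper coloring of $H$ with colors $\{1,\dots,q\}$ chosen uniformly at random. Then for vertices $u,v$ of $H$: (i) if $u$ and $v$ lie in different parts of the bipartition, then $\mathbb{P}(c(u)=c(v))\leq \frac{1}{q}$; (ii) if $u$ and $v$ lie in the same part of the bipartition, then $\mathbb{P}(c(u)=c(v))\geq \frac{1}{q}$. Part (i) is equivalent to the statement that for any such bipartite graph $H$ and any pair $e=\{u,v\}\notin E(H)$ with $u\in A$, $v\in B$, we have $$\frac{\mathrm{ch}(H+e,q)}{\mathrm{ch}(H,q)}\geq \frac{q-1}{q}.$$
   Context: A proper coloring of a graph with $q$ colors is a map from its vertex set to $\{1,\dots,q\}$ such that adjacent vertices receive different colors. $\mathrm{ch}(H,q)$ denotes the number of proper colorings of $H$ with $q$ colors (equivalently, the number of graph homomorphisms from $H$ to the complete graph $K_q$). $H+e$ denotes the graph obtained from $H$ by adding the edge $e$. *)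

theory Defs
  imports "HOL-Probability.Probability"
begin

text \<open>A graph is given by its vertex set and its set of edges, an edge being the
  two-element set of its end points; so \<^term>\<open>insert {u, v} E\<close> is the edge set of
  \<open>H + e\<close> for \<open>e = {u, v}\<close>.\<close>

definition bipartite_graph :: "'a set \<Rightarrow> 'a set \<Rightarrow> 'a set set \<Rightarrow> bool" where
  "bipartite_graph A B E \<longleftrightarrow>
     finite A \<and> finite B \<and> A \<inter> B = {} \<and> (\<forall>e\<in>E. \<exists>a\<in>A. \<exists>b\<in>B. e = {a, b})"

text \<open>Colorings are extensional functions on the vertex set, so that each map from the
  vertices to the colors is counted exactly once.\<close>

definition proper_colorings :: "'a set \<Rightarrow> 'a set set \<Rightarrow> nat \<Rightarrow> ('a \<Rightarrow> nat) set" where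
  "proper_colorings V E q =
     {c \<in> V \<rightarrow>\<^sub>E {1..q}. \<forall>x\<in>V. \<forall>y\<in>V. {x, y} \<in> E \<longrightarrow> c x \<noteq> c y}"

definition ch :: "'a set \<Rightarrow> 'a set set \<Rightarrow> nat \<Rightarrow> nat" where
  "ch V E q = card (proper_colorings V E q)"

definition random_coloring :: "'a set \<Rightarrow> 'a set set \<Rightarrow> nat \<Rightarrow> ('a \<Rightarrow> nat) pmf" where
  "random_coloring V E q = pmf_of_set (proper_colorings V E q)"

text \<open>\<^const>\<open>pmf_of_set\<close> is meaningful only for finite nonempty sets.\<close>

lemma finite_proper_colorings: "finite V \<Longrightarrow> finite (proper_colorings V E q)"
  unfolding proper_colorings_def by (simp add: finite_PiE)

definition different_parts :: "'a set \<Rightarrow> 'a set \<Rightarrow> 'a \<Rightarrow> 'a \<Rightarrow> bool" where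
  "different_parts A B u v \<longleftrightarrow> (u \<in> A \<and> v \<in> B) \<or> (u \<in> B \<and> v \<in> A)"

definition same_part :: "'a set \<Rightarrow> 'a set \<Rightarrow> 'a \<Rightarrow> 'a \<Rightarrow> bool" where
  "same_part A B u v \<longleftrightarrow> (u \<in> A \<and> v \<in> A) \<or> (u \<in> B \<and> v \<in> B)"

end

theory Submission
  imports Defs "HOL-Combinatorics.Transposition"
begin

text \<open>Fix two colors \<open>i \<noteq> j\<close> and let \<open>K\<close> be the Kempe chain of \<open>v\<close>: the component of \<open>v\<close> in the
  subgraph induced by the vertices of color \<open>i\<close> or \<open>j\<close>. Since the graph is bipartite, a vertex of
  \<open>K\<close> has the color of \<open>v\<close> if and only if it lies in the same part as \<open>v\<close>. Exchanging \<open>i\<close> and \<open>j\<close>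
  on \<open>K\<close> is an involution on proper colorings. If \<open>u\<close> and \<open>v\<close> lie in the same part and
  \<open>c u = i\<close>, \<open>c v = j\<close>, then \<open>u\<close> is not in \<open>K\<close>, so the exchange makes both colors equal to \<open>i\<close>; hence
  \<open>N i j \<le> N i i\<close> for the numbers \<open>N i j\<close> of proper colorings with these prescribed colors at \<open>u\<close>
  and \<open>v\<close>. If they lie in different parts, the exchange shows \<open>N i i \<le> N i j\<close>. Summing over
  \<open>i\<close> and \<open>j\<close> compares \<open>q\<close> times the number of colorings with \<open>c u = c v\<close> to the number of all
  colorings.\<close>

section \<open>Kempe chains and the exchange of two colors\<close>

definition bicolored_edges :: "'a set \<Rightarrow> 'a set set \<Rightarrow> nat \<Rightarrow> nat \<Rightarrow> ('a \<Rightarrow> nat) \<Rightarrow> ('a \<times> 'a) set" where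
  "bicolored_edges V E i j c =
     {(x, y). x \<in> V \<and> y \<in> V \<and> {x, y} \<in> E \<and> c x \<in> {i, j} \<and> c y \<in> {i, j}}"

text \<open>If the color of \<open>v\<close> is neither \<open>i\<close> nor \<open>j\<close>, the
  chain is just \<open>{v}\<close> and the exchange below changes nothing.\<close>

definition kempe_chain :: "'a set \<Rightarrow> 'a set set \<Rightarrow> nat \<Rightarrow> nat \<Rightarrow> 'a \<Rightarrow> ('a \<Rightarrow> nat) \<Rightarrow> 'a set" where
  "kempe_chain V E i j v c = (bicolored_edges V E i j c)\<^sup>* `` {v}"

definition kempe_swap :: "'a set \<Rightarrow> 'a set set \<Rightarrow> nat \<Rightarrow> nat \<Rightarrow> 'a \<Rightarrow> ('a \<Rightarrow> nat) \<Rightarrow> 'a \<Rightarrow> nat" where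
  "kempe_swap V E i j v c =
     (\<lambda>w. if w \<in> kempe_chain V E i j v c then Transposition.transpose i j (c w) else c w)"

lemma transpose_in_pair_iff: "Transposition.transpose i j x \<in> {i, j} \<longleftrightarrow> x \<in> {i, j}"
  by (auto simp: Transposition.transpose_def)

lemma kempe_chain_self: "v \<in> kempe_chain V E i j v c"
  by (simp add: kempe_chain_def)

lemma kempe_chain_step:
  assumes "x \<in> kempe_chain V E i j v c" "(x, y) \<in> bicolored_edges V E i j c"
  shows "y \<in> kempe_chain V E i j v c"
  using assms unfolding kempe_chain_def by (auto intro: rtrancl_into_rtrancl)

lemma kempe_chain_bicolored:
  assumes "w \<in> kempe_chain V E i j v c" "v \<in> V" "c v \<in> {i, j}"
  shows "w \<in> V \<and> c w \<in> {i, j}"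
proof -
  have "(v, w) \<in> (bicolored_edges V E i j c)\<^sup>*"
    using assms(1) by (simp add: kempe_chain_def)
  then show ?thesis
    by (induction rule: rtrancl_induct) (use assms(2,3) in \<open>auto simp: bicolored_edges_def\<close>)
qed

text \<open>The exchange only permutes \<open>i\<close> and \<open>j\<close>, so the bicolored edges
  stay the same.\<close>

lemma kempe_chain_kempe_swap:
  "kempe_chain V E i j v (kempe_swap V E i j v c) = kempe_chain V E i j v c"
proof -
  have "kempe_swap V E i j v c x \<in> {i, j} \<longleftrightarrow> c x \<in> {i, j}" for x
    using transpose_in_pair_iff[of i j "c x"] by (simp add: kempe_swap_def)
  then have "bicolored_edges V E i j (kempe_swap V E i j v c) = bicolored_edges V E i j c"
    unfolding bicolored_edges_def by presburger
  then show ?thesis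
    by (simp add: kempe_chain_def)
qed

lemma kempe_swap_involutory: "kempe_swap V E i j v (kempe_swap V E i j v c) = c"
proof
  fix w
  show "kempe_swap V E i j v (kempe_swap V E i j v c) w = c w"
    \<comment> \<open>Only the outer exchange is unfolded first; its chain is that of
      \<open>c\<close>, so both exchanges transpose colors at the same vertices.\<close>
    by (subst kempe_swap_def, subst kempe_chain_kempe_swap) (simp add: kempe_swap_def)
qed

text \<open>On an edge inside the chain both colors are transposed and stay distinct. On an edge
  leaving it, the inner end keeps a color in \<open>{i, j}\<close>, while the outer end has another
  color, as otherwise it would belong to the chain.\<close>

lemma kempe_swap_proper:
  assumes c: "c \<in> proper_colorings V E q"
    and v: "v \<in> V" "c v \<in> {i, j}" and ij: "i \<in> {1..q}" "j \<in> {1..q}"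
  shows "kempe_swap V E i j v c \<in> proper_colorings V E q"
proof -
  let ?K = "kempe_chain V E i j v c"
  have K: "w \<in> V" "c w \<in> {i, j}" if "w \<in> ?K" for w
    using kempe_chain_bicolored[OF that v] by auto
  have proper: "c x \<noteq> c y" if "x \<in> V" "y \<in> V" "{x, y} \<in> E" for x y
    using c that by (auto simp: proper_colorings_def)
  have "c \<in> V \<rightarrow>\<^sub>E {1..q}"
    using c by (auto simp: proper_colorings_def)
  \<comment> \<open>The chain lies in \<open>V\<close>, so the value \<open>undefined\<close>
    outside \<open>V\<close> is kept and the result is extensional.\<close>
  then have range: "kempe_swap V E i j v c \<in> V \<rightarrow>\<^sub>E {1..q}"
    using K ij by (fastforce simp: kempe_swap_def PiE_iff extensional_def Transposition.transpose_def)
  have boundary: "Transposition.transpose i j (c x) \<noteq> c y"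
    if "x \<in> V" "y \<in> V" "{x, y} \<in> E" "x \<in> ?K" "y \<notin> ?K" for x y
  proof -
    have "c y \<notin> {i, j}"
      using kempe_chain_step[OF that(4), of y] that K(2)[OF that(4)]
      by (auto simp: bicolored_edges_def)
    then show ?thesis
      using K(2)[OF that(4)] transpose_in_pair_iff[of i j "c x"] by metis
  qed
  have "kempe_swap V E i j v c x \<noteq> kempe_swap V E i j v c y"
    if "x \<in> V" "y \<in> V" "{x, y} \<in> E" for x y
    using proper[OF that] boundary[OF that] boundary[of y x] that
    by (auto simp: kempe_swap_def insert_commute dest: injD[OF inj_transpose])
  with range show ?thesis
    by (simp add: proper_colorings_def)
qed

text \<open>Each step along the chain changes the part, by bipartiteness, and also the color, since
  only two colors are available.\<close>

lemma kempe_chain_color_eq_iff_same_part: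
  assumes bip: "bipartite_graph A B E"
    and c: "c \<in> proper_colorings (A \<union> B) E q"
    and w: "w \<in> kempe_chain (A \<union> B) E i j v c"
  shows "c w = c v \<longleftrightarrow> (w \<in> A \<longleftrightarrow> v \<in> A)"
proof -
  have "(v, w) \<in> (bicolored_edges (A \<union> B) E i j c)\<^sup>*"
    using w by (simp add: kempe_chain_def)
  then show ?thesis
  proof (induction rule: rtrancl_induct)
    case base
    then show ?case by simp
  next
    case (step x y)
    then have xy: "x \<in> A \<union> B" "y \<in> A \<union> B" "{x, y} \<in> E" "c x \<in> {i, j}" "c y \<in> {i, j}"
      by (auto simp: bicolored_edges_def)
    have "c x \<noteq> c y"
      using c xy by (auto simp: proper_colorings_def)
    moreover have "x \<in> A \<longleftrightarrow> y \<notin> A"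
      using bip xy(3) unfolding bipartite_graph_def by (fastforce simp: doubleton_eq_iff)
    \<comment> \<open>Either \<open>x\<close> is \<open>v\<close>, or the path starts with a
      bicolored edge at \<open>v\<close>. With three colors in \<open>{i, j}\<close>,
      \<open>c y \<noteq> c x\<close> means that exactly one of \<open>c x\<close>,
      \<open>c y\<close> equals \<open>c v\<close>.\<close>
    moreover have "c v \<in> {i, j}"
      using step.hyps(1) xy(4)
      by (cases rule: converse_rtranclE) (auto simp: bicolored_edges_def)
    ultimately show ?case
      using step.IH xy(4,5) by auto
  qed
qed

section \<open>Comparison of colorings with prescribed colors at two vertices\<close>

definition colorings_with :: "'a set \<Rightarrow> 'a set set \<Rightarrow> nat \<Rightarrow> 'a \<Rightarrow> 'a \<Rightarrow> nat \<Rightarrow> nat \<Rightarrow> ('a \<Rightarrow> nat) set" where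
  "colorings_with V E q u v i j = {c \<in> proper_colorings V E q. c u = i \<and> c v = j}"

lemma finite_colorings_with: "finite V \<Longrightarrow> finite (colorings_with V E q u v i j)"
  by (simp add: colorings_with_def finite_proper_colorings)

text \<open>Both parity cases at once: \<open>k = j\<close> serves the same part,
  \<open>k = i\<close> different parts. By \<open>sep\<close>, the colors at \<open>u\<close> and
  \<open>v\<close> contradict the parity rule of the chain, so \<open>u\<close> lies outside it and
  only \<open>v\<close> is recolored; injectivity comes from the involution.\<close>

lemma card_colorings_with_le:
  assumes bip: "bipartite_graph A B E"
    and uv: "u \<in> A \<union> B" "v \<in> A \<union> B" and ij: "i \<in> {1..q}" "j \<in> {1..q}"
    and k: "k \<in> {i, j}"
    and sep: "i = k \<longleftrightarrow> \<not> (u \<in> A \<longleftrightarrow> v \<in> A)"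
  shows "card (colorings_with (A \<union> B) E q u v i k)
       \<le> card (colorings_with (A \<union> B) E q u v i (Transposition.transpose i j k))"
proof (rule card_inj_on_le)
  let ?s = "kempe_swap (A \<union> B) E i j v"
  show "inj_on ?s (colorings_with (A \<union> B) E q u v i k)"
    by (metis inj_onI kempe_swap_involutory)
  show "finite (colorings_with (A \<union> B) E q u v i (Transposition.transpose i j k))"
    using bip by (simp add: finite_colorings_with bipartite_graph_def)
  show "?s ` colorings_with (A \<union> B) E q u v i k \<subseteq>
      colorings_with (A \<union> B) E q u v i (Transposition.transpose i j k)"
  proof (rule image_subsetI)
    fix c assume "c \<in> colorings_with (A \<union> B) E q u v i k"
    then have c: "c \<in> proper_colorings (A \<union> B) E q" "c u = i" "c v = k"
      by (auto simp: colorings_with_def)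
    have "u \<notin> kempe_chain (A \<union> B) E i j v c"
      using kempe_chain_color_eq_iff_same_part[OF bip c(1), of u i j v] c sep by auto
    then have "?s c u = i" "?s c v = Transposition.transpose i j k"
      using c by (auto simp: kempe_swap_def kempe_chain_self)
    then show "?s c \<in> colorings_with (A \<union> B) E q u v i (Transposition.transpose i j k)"
      using kempe_swap_proper[OF c(1) uv(2) _ ij] c(3) k by (simp add: colorings_with_def)
  qed
qed

lemma card_colorings_with_same_part:
  assumes "bipartite_graph A B E" "same_part A B u v" "i \<in> {1..q}" "j \<in> {1..q}"
  shows "card (colorings_with (A \<union> B) E q u v i j) \<le> card (colorings_with (A \<union> B) E q u v i i)"
\<comment> \<open>For \<open>i = j\<close> the condition \<open>sep\<close> would fail, but both
  sides coincide.\<close>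
proof (cases "i = j")
  case False
  then show ?thesis
    using assms card_colorings_with_le[of A B E u v i q j j]
    by (auto simp: same_part_def bipartite_graph_def)
qed simp

lemma card_colorings_with_different_parts:
  assumes "bipartite_graph A B E" "different_parts A B u v" "i \<in> {1..q}" "j \<in> {1..q}"
  shows "card (colorings_with (A \<union> B) E q u v i i) \<le> card (colorings_with (A \<union> B) E q u v i j)"
  using assms card_colorings_with_le[of A B E u v i q j i]
  by (auto simp: different_parts_def bipartite_graph_def)

section \<open>Summation over colors and the probability bounds\<close>

lemma proper_colorings_range: "c \<in> proper_colorings V E q \<Longrightarrow> x \<in> V \<Longrightarrow> c x \<in> {1..q}"
  by (auto simp: proper_colorings_def)

text \<open>The colors at \<open>u\<close> and \<open>v\<close> partition the proper
  colorings.\<close>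

lemma ch_eq_sum_colorings_with:
  assumes "finite V" "u \<in> V" "v \<in> V"
  shows "ch V E q = (\<Sum>i\<in>{1..q}. \<Sum>j\<in>{1..q}. card (colorings_with V E q u v i j))"
proof -
  have "proper_colorings V E q =
      (\<Union>p\<in>{1..q} \<times> {1..q}. colorings_with V E q u v (fst p) (snd p))"
    using proper_colorings_range[OF _ assms(2)] proper_colorings_range[OF _ assms(3)]
    by (auto simp: colorings_with_def)
  also have "card \<dots> = (\<Sum>p\<in>{1..q} \<times> {1..q}. card (colorings_with V E q u v (fst p) (snd p)))"
    by (rule card_UN_disjoint)
      (auto simp: finite_colorings_with assms(1), auto simp: colorings_with_def)
  finally show ?thesis
    by (simp add: ch_def sum.cartesian_product split_beta)
qed

definition monochromatic :: "'a set \<Rightarrow> 'a set set \<Rightarrow> nat \<Rightarrow> 'a \<Rightarrow> 'a \<Rightarrow> ('a \<Rightarrow> nat) set" where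
  "monochromatic V E q u v = {c \<in> proper_colorings V E q. c u = c v}"

lemma card_monochromatic:
  assumes "finite V" "u \<in> V" "v \<in> V"
  shows "card (monochromatic V E q u v) = (\<Sum>i\<in>{1..q}. card (colorings_with V E q u v i i))"
proof -
  have "monochromatic V E q u v = (\<Union>i\<in>{1..q}. colorings_with V E q u v i i)"
    using proper_colorings_range[OF _ assms(3)] by (auto simp: monochromatic_def colorings_with_def)
  also have "card \<dots> = (\<Sum>i\<in>{1..q}. card (colorings_with V E q u v i i))"
    by (rule card_UN_disjoint)
      (auto simp: finite_colorings_with assms(1), auto simp: colorings_with_def)
  finally show ?thesis .
qed

lemma prob_monochromatic:
  assumes "finite V" "proper_colorings V E q \<noteq> {}"
  shows "measure_pmf.prob (random_coloring V E q) {c. c u = c v}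
       = real (card (monochromatic V E q u v)) / real (ch V E q)"
proof -
  have "proper_colorings V E q \<inter> {c. c u = c v} = monochromatic V E q u v"
    by (auto simp: monochromatic_def)
  then show ?thesis
    using assms by (simp add: random_coloring_def measure_pmf_of_set finite_proper_colorings ch_def)
qed

lemma ch_pos: "finite V \<Longrightarrow> proper_colorings V E q \<noteq> {} \<Longrightarrow> ch V E q > 0"
  by (simp add: ch_def card_gt_0_iff finite_proper_colorings)

lemma prob_monochromatic_same_part:
  assumes bip: "bipartite_graph A B E" and q: "q > 0"
    and ne: "proper_colorings (A \<union> B) E q \<noteq> {}" and uv: "same_part A B u v"
  shows "measure_pmf.prob (random_coloring (A \<union> B) E q) {c. c u = c v} \<ge> 1 / real q"
proof -
  have fin: "finite (A \<union> B)" and mem: "u \<in> A \<union> B" "v \<in> A \<union> B"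
    using bip uv by (auto simp: bipartite_graph_def same_part_def)
  \<comment> \<open>Every entry of row \<open>i\<close> is bounded by the diagonal one, which then
    occurs \<open>q\<close> times.\<close>
  have "ch (A \<union> B) E q \<le> (\<Sum>i\<in>{1..q}. \<Sum>j\<in>{1..q}. card (colorings_with (A \<union> B) E q u v i i))"
    unfolding ch_eq_sum_colorings_with[OF fin mem]
    by (intro sum_mono card_colorings_with_same_part[OF bip uv])
  also have "\<dots> = q * card (monochromatic (A \<union> B) E q u v)"
    by (simp add: card_monochromatic[OF fin mem] sum_distrib_left)
  finally have "real (ch (A \<union> B) E q) \<le> real q * real (card (monochromatic (A \<union> B) E q u v))"
    by (metis of_nat_le_iff of_nat_mult)
  then show ?thesis
    using q ch_pos[OF fin ne] by (simp add: prob_monochromatic[OF fin ne] field_simps)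
qed

lemma prob_monochromatic_different_parts:
  assumes bip: "bipartite_graph A B E" and q: "q > 0"
    and ne: "proper_colorings (A \<union> B) E q \<noteq> {}" and uv: "different_parts A B u v"
  shows "measure_pmf.prob (random_coloring (A \<union> B) E q) {c. c u = c v} \<le> 1 / real q"
proof -
  have fin: "finite (A \<union> B)" and mem: "u \<in> A \<union> B" "v \<in> A \<union> B"
    using bip uv by (auto simp: bipartite_graph_def different_parts_def)
  have "q * card (monochromatic (A \<union> B) E q u v)
      = (\<Sum>i\<in>{1..q}. \<Sum>j\<in>{1..q}. card (colorings_with (A \<union> B) E q u v i i))"
    by (simp add: card_monochromatic[OF fin mem] sum_distrib_left)
  also have "\<dots> \<le> ch (A \<union> B) E q"
    unfolding ch_eq_sum_colorings_with[OF fin mem]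
    by (intro sum_mono card_colorings_with_different_parts[OF bip uv])
  finally have "real q * real (card (monochromatic (A \<union> B) E q u v)) \<le> real (ch (A \<union> B) E q)"
    by (metis of_nat_le_iff of_nat_mult)
  then show ?thesis
    using q ch_pos[OF fin ne] by (simp add: prob_monochromatic[OF fin ne] field_simps)
qed

section \<open>Adding an edge\<close>

lemma ch_insert_edge:
  assumes fin: "finite V" and uv: "u \<in> V" "v \<in> V"
  shows "real (ch V (insert {u, v} E) q) = real (ch V E q) - real (card (monochromatic V E q u v))"
proof -
  have "proper_colorings V (insert {u, v} E) q = proper_colorings V E q - monochromatic V E q u v"
    using uv by (fastforce simp: proper_colorings_def monochromatic_def doubleton_eq_iff)
  moreover have sub: "monochromatic V E q u v \<subseteq> proper_colorings V E q"
    by (auto simp: monochromatic_def)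
  ultimately show ?thesis
    using finite_proper_colorings[OF fin, of E q]
    by (simp add: ch_def card_Diff_subset finite_subset card_mono)
qed

text \<open>The ratio is one minus the probability, and \<open>(q - 1) / q\<close> is one minus
  \<open>1 / q\<close>.\<close>

lemma prob_le_iff_ch_ratio_ge:
  assumes fin: "finite V" and uv: "u \<in> V" "v \<in> V" and q: "q > 0"
    and ne: "proper_colorings V E q \<noteq> {}"
  shows "measure_pmf.prob (random_coloring V E q) {c. c u = c v} \<le> 1 / real q
     \<longleftrightarrow> real (ch V (insert {u, v} E) q) / real (ch V E q) \<ge> (real q - 1) / real q"
  using q ch_pos[OF fin ne]
  by (simp add: prob_monochromatic[OF fin ne] ch_insert_edge[OF fin uv] diff_divide_distrib)

theorem theorem1p1:
  fixes A B :: "'a set" and E :: "'a set set" and q :: nat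
  assumes "bipartite_graph A B E"
    and "q > 0"
    and "proper_colorings (A \<union> B) E q \<noteq> {}"
  shows
    "(\<forall>u v. different_parts A B u v \<longrightarrow>
        measure_pmf.prob (random_coloring (A \<union> B) E q) {c. c u = c v} \<le> 1 / real q)
   \<and> (\<forall>u v. same_part A B u v \<longrightarrow>
        measure_pmf.prob (random_coloring (A \<union> B) E q) {c. c u = c v} \<ge> 1 / real q)
   \<and> (\<forall>u\<in>A. \<forall>v\<in>B. {u, v} \<notin> E \<longrightarrow>
        (measure_pmf.prob (random_coloring (A \<union> B) E q) {c. c u = c v} \<le> 1 / real q
         \<longleftrightarrow> real (ch (A \<union> B) (insert {u, v} E) q) / real (ch (A \<union> B) E q)
               \<ge> (real q - 1) / real q))
   \<and> ((\<forall>(A' :: 'a set) B' E'.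
         bipartite_graph A' B' E' \<and> proper_colorings (A' \<union> B') E' q \<noteq> {} \<longrightarrow>
         (\<forall>u v. different_parts A' B' u v \<longrightarrow>
            measure_pmf.prob (random_coloring (A' \<union> B') E' q) {c. c u = c v} \<le> 1 / real q))
      \<longleftrightarrow>
      (\<forall>(A' :: 'a set) B' E'.
         bipartite_graph A' B' E' \<and> proper_colorings (A' \<union> B') E' q \<noteq> {} \<longrightarrow>
         (\<forall>u\<in>A'. \<forall>v\<in>B'. {u, v} \<notin> E' \<longrightarrow>
            real (ch (A' \<union> B') (insert {u, v} E') q) / real (ch (A' \<union> B') E' q)
              \<ge> (real q - 1) / real q)))"
proof -
  \<comment> \<open>The graph is arbitrary here because the last conjunct quantifies over all
    bipartite graphs on the type.\<close>
  have ratio_iff: "measure_pmf.prob (random_coloring (A' \<union> B') E' q) {c. c u = c v} \<le> 1 / real q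
      \<longleftrightarrow> real (ch (A' \<union> B') (insert {u, v} E') q) / real (ch (A' \<union> B') E' q)
            \<ge> (real q - 1) / real q"
    if "bipartite_graph A' B' E'" "proper_colorings (A' \<union> B') E' q \<noteq> {}" "u \<in> A'" "v \<in> B'"
    for A' B' :: "'a set" and E' u v
    using prob_le_iff_ch_ratio_ge[of "A' \<union> B'" u v q E'] that assms(2)
    by (auto simp: bipartite_graph_def)
  have different: "measure_pmf.prob (random_coloring (A' \<union> B') E' q) {c. c u = c v} \<le> 1 / real q"
    if "bipartite_graph A' B' E'" "proper_colorings (A' \<union> B') E' q \<noteq> {}" "different_parts A' B' u v"
    for A' B' :: "'a set" and E' u v
    by (rule prob_monochromatic_different_parts[OF that(1) assms(2) that(2,3)])
  have ratio: "real (ch (A' \<union> B') (insert {u, v} E') q) / real (ch (A' \<union> B') E' q)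
      \<ge> (real q - 1) / real q"
    if "bipartite_graph A' B' E'" "proper_colorings (A' \<union> B') E' q \<noteq> {}" "u \<in> A'" "v \<in> B'"
    for A' B' :: "'a set" and E' u v
    using ratio_iff[OF that] different[OF that(1,2), of u v] that(3,4)
    by (simp add: different_parts_def)
  \<comment> \<open>In the last conjunct, \<open>different\<close> proves one universal statement
    and \<open>ratio\<close> the other.\<close>
  show ?thesis
    using assms different ratio ratio_iff prob_monochromatic_same_part[OF assms]
    by (intro conjI iffI allI ballI impI) simp_all
qed

end
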